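(* Let $\mathbb{F}$ be an algebraically closed field with $\mathrm{Char}(\mathbb{F})\neq 2$, let $p\in\mathbb{F}$ with $p\ne 0$, $p\neq 1$, let $N$ be a feasible integer, and let $V=\mathrm{Span}\{y^{N-i}z^i\}_{i=0}^N\subset\mathbb{F}[y,z]$ be the space of homogeneous polynomials of total degree $N$ in commuting indeterminates $y,z$. For $i=0,\ldots,N$ put $k_i=\binom{N}{i}\left(\frac{p}{1-p}\right)^i$, and let $\langle\,,\,\rangle:V\times V\to\mathbb{F}$ be the bilinear form with $$\langle y^{N-i}z^i,y^{N-j}z^j\rangle=\delta_{i,j}\frac{1}{k_i(1-p)^N},\qquad i,j=0,1,\ldots,N.$$ Let $y^*=(1-p)y+pz$ and $z^*=(1-p)y+(p-1)z$. Then for $i,j=0,1,\ldots,N$, $$\langle {y^*}^{N-i}{z^*}^{i},{y^*}^{N-j}{z^*}^{j}\rangle=\delta_{i,j}\,k_i^{-1}.$$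
   Context: An integer $N$ is feasible if $N\ge 0$ when $\mathrm{Char}(\mathbb{F})=0$, and $0\le N<\mathrm{Char}(\mathbb{F})$ when $\mathrm{Char}(\mathbb{F})>0$. *)

theory Defs
  imports "HOL-Computational_Algebra.Computational_Algebra"
begin

definition feasible :: "'a::field itself \<Rightarrow> int \<Rightarrow> bool" where
  "feasible _ N \<longleftrightarrow> 0 \<le> N \<and> (CHAR('a) > 0 \<longrightarrow> N < int CHAR('a))"

text \<open>
  The polynomial ring \<open>F[y,z]\<close> is represented as \<open>F[y][z]\<close>: the outer indeterminate is \<open>z\<close>,
  the inner one is \<open>y\<close>, and a scalar \<open>c\<close> corresponds to \<open>[:[:c:]:]\<close>.
\<close>

definition var_y :: "'a::field poly poly" where
  "var_y = [:[:0, 1:]:]"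

definition var_z :: "'a::field poly poly" where
  "var_z = [:0, 1:]"

definition scale2 :: "'a::field \<Rightarrow> 'a poly poly \<Rightarrow> 'a poly poly" where
  "scale2 c f = smult [:c:] f"

global_interpretation poly2: vector_space "scale2 :: 'a::field \<Rightarrow> 'a poly poly \<Rightarrow> 'a poly poly"
proof
  fix a b :: 'a and f g :: "'a poly poly"
  show "scale2 a (f + g) = scale2 a f + scale2 a g"
    by (simp add: scale2_def smult_add_right)
  show "scale2 (a + b) f = scale2 a f + scale2 b f"
    by (simp add: scale2_def flip: smult_add_left)
  show "scale2 a (scale2 b f) = scale2 (a * b) f"
    by (simp add: scale2_def mult.commute)
  show "scale2 1 f = f"
    by (simp add: scale2_def flip: one_pCons)
qed

definition homogeneous_space :: "nat \<Rightarrow> 'a::field poly poly set" where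
  "homogeneous_space N = poly2.span {var_y ^ (N - i) * var_z ^ i | i. i \<le> N}"

text \<open>
  A form on \<open>V\<close> is a function on all of \<open>F[y,z] \<times> F[y,z]\<close>; its values outside \<open>V \<times> V\<close> are
  arbitrary.
\<close>

definition bilinear_form_on ::
    "'a::field poly poly set \<Rightarrow> ('a poly poly \<Rightarrow> 'a poly poly \<Rightarrow> 'a) \<Rightarrow> bool" where
  "bilinear_form_on V B \<longleftrightarrow>
     (\<forall>u\<in>V. \<forall>v\<in>V. \<forall>w\<in>V. B (u + v) w = B u w + B v w \<and> B w (u + v) = B w u + B w v) \<and>
     (\<forall>c. \<forall>u\<in>V. \<forall>v\<in>V. B (scale2 c u) v = c * B u v \<and> B u (scale2 c v) = c * B u v)"

definition kcoeff :: "nat \<Rightarrow> 'a::field \<Rightarrow> nat \<Rightarrow> 'a" where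
  "kcoeff N p i = of_nat (N choose i) * (p / (1 - p)) ^ i"

definition y_star :: "'a::field \<Rightarrow> 'a poly poly" where
  "y_star p = scale2 (1 - p) var_y + scale2 p var_z"

definition z_star :: "'a::field \<Rightarrow> 'a poly poly" where
  "z_star p = scale2 (1 - p) var_y + scale2 (p - 1) var_z"

end

theory Submission
  imports Defs
begin

text \<open>
  Pairing with the \<open>N\<close>-th power of a linear form is evaluation at a point: for \<open>f \<in> V\<close>,
  \<open>\<langle>f, (a y + b z)\<^sup>N\<rangle> = f (a / (1 - p), b / p)\<close>. Taking the linear form \<open>y\<^sup>* + t z\<^sup>*\<close>, the evaluation
  point is one where \<open>y\<^sup>*\<close> has value \<open>1\<close> and \<open>z\<^sup>*\<close> has value \<open>t (1 - p) / p\<close>. Hence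
  \<open>\<Sum>\<^sub>j (N choose j) t\<^sup>j \<langle>y\<^sup>*\<^bsup>N-i\<^esup> z\<^sup>*\<^bsup>i\<^esup>, y\<^sup>*\<^bsup>N-j\<^esup> z\<^sup>*\<^bsup>j\<^esup>\<rangle> = t\<^sup>i ((1 - p) / p)\<^sup>i\<close> for all \<open>t\<close>, and the claim
  follows by comparing coefficients of \<open>t\<close>; feasibility provides \<open>N + 1\<close> distinct values of \<open>t\<close>
  and makes the binomial coefficients invertible.
\<close>

text \<open>The outer indeterminate is z, so it is replaced first, by the constant polynomial
  \<open>[:b:]\<close>; the remaining polynomial in y is then evaluated at \<open>a\<close>.\<close>

definition eval2 :: "'a::field \<Rightarrow> 'a \<Rightarrow> 'a poly poly \<Rightarrow> 'a" where
  "eval2 a b f = poly (poly f [:b:]) a"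

lemma eval2_simps [simp]:
  "eval2 a b 0 = 0"
  "eval2 a b var_y = a"
  "eval2 a b var_z = b"
  "eval2 a b (f + g) = eval2 a b f + eval2 a b g"
  "eval2 a b (f * g) = eval2 a b f * eval2 a b g"
  "eval2 a b (f ^ n) = eval2 a b f ^ n"
  "eval2 a b (scale2 c f) = c * eval2 a b f"
  by (simp_all add: eval2_def var_y_def var_z_def scale2_def poly_power)

lemma scale2_mult_left: "scale2 c f * g = scale2 c (f * g)"
  and scale2_mult_right: "f * scale2 c g = scale2 c (f * g)"
  by (simp_all add: scale2_def)

lemma scale2_power: "scale2 c f ^ n = scale2 (c ^ n) (f ^ n)"
  by (induction n) (simp_all add: scale2_mult_left scale2_mult_right mult.commute)

lemma of_nat_mult_eq_scale2: "of_nat n * f = scale2 (of_nat n) f"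
  by (simp add: scale2_def of_nat_poly)

lemma power_scale2_add:
  "(scale2 a u + scale2 b v) ^ N =
     (\<Sum>j\<le>N. scale2 (of_nat (N choose j) * a ^ (N - j) * b ^ j) (u ^ (N - j) * v ^ j))"
  \<comment> \<open>\<open>binomial_ring\<close> puts the summation index on the first summand; the
    swap moves it to \<open>v\<close>, as in the monomials spanning V.\<close>
  by (subst add.commute, subst binomial_ring)
     (simp add: scale2_power scale2_mult_left scale2_mult_right of_nat_mult_eq_scale2 ac_simps)

lemma var_mult_in_homogeneous_space:
  assumes "f \<in> homogeneous_space n"
  shows "var_y * f \<in> homogeneous_space (Suc n)" "var_z * f \<in> homogeneous_space (Suc n)"
proof -
  have "var_y * f \<in> homogeneous_space (Suc n) \<and> var_z * f \<in> homogeneous_space (Suc n)"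
    using assms unfolding homogeneous_space_def
  proof (induction rule: poly2.span_induct_alt)
    case base
    then show ?case by (simp add: poly2.span_zero)
  next
    case (step c x g)
    then obtain i where i: "i \<le> n" and x: "x = var_y ^ (n - i) * var_z ^ i"
      by auto
    have "var_y * x = var_y ^ (Suc n - i) * var_z ^ i"
      using i by (simp add: x Suc_diff_le)
    moreover have "var_z * x = var_y ^ (Suc n - Suc i) * var_z ^ Suc i"
      by (simp add: x)
    ultimately have "var_y * x \<in> {var_y ^ (Suc n - i) * var_z ^ i | i. i \<le> Suc n}"
      "var_z * x \<in> {var_y ^ (Suc n - i) * var_z ^ i | i. i \<le> Suc n}"
      using i by (blast intro: le_SucI, blast)
    with step.IH show ?case
      by (simp add: distrib_left scale2_mult_right poly2.span_add poly2.span_scale poly2.span_base)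
  qed
  then show "var_y * f \<in> homogeneous_space (Suc n)" "var_z * f \<in> homogeneous_space (Suc n)"
    by simp_all
qed

lemma linear_mult_in_homogeneous_space:
  assumes "f \<in> homogeneous_space n"
  shows "(scale2 a var_y + scale2 b var_z) * f \<in> homogeneous_space (Suc n)"
  using var_mult_in_homogeneous_space[OF assms]
  by (simp add: homogeneous_space_def distrib_right scale2_mult_left poly2.span_add poly2.span_scale)

lemma linear_power_mult_in_homogeneous_space:
  assumes "f \<in> homogeneous_space n"
  shows "(scale2 a var_y + scale2 b var_z) ^ m * f \<in> homogeneous_space (m + n)"
proof (induction m)
  case (Suc m)
  then show ?case
    using linear_mult_in_homogeneous_space[of _ "m + n" a b] by (simp add: mult.assoc)
qed (simp add: assms)

text \<open>The form is controlled only on V, so every product of powers of linear forms fed to it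
  must first be placed there. Starting from 1 in degree 0, each linear factor raises the degree by
  one.\<close>

lemma linear_powers_in_homogeneous_space:
  assumes "i \<le> N"
  shows "(scale2 a var_y + scale2 b var_z) ^ (N - i) * (scale2 c var_y + scale2 d var_z) ^ i
    \<in> homogeneous_space N"
proof -
  have "1 \<in> homogeneous_space 0"
    by (auto simp: homogeneous_space_def intro: poly2.span_base)
  from linear_power_mult_in_homogeneous_space[OF this, of c d i]
  have "(scale2 c var_y + scale2 d var_z) ^ i \<in> homogeneous_space i"
    by simp
  from linear_power_mult_in_homogeneous_space[OF this, of a b "N - i"] assms
  show ?thesis by simp
qed

lemma bilinear_form_on_sum_right:
  assumes B: "bilinear_form_on (homogeneous_space N) B"
    and f: "f \<in> homogeneous_space N"
    and g: "\<And>j. j \<in> J \<Longrightarrow> g j \<in> homogeneous_space N"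
  shows "B f (\<Sum>j\<in>J. scale2 (c j) (g j)) = (\<Sum>j\<in>J. c j * B f (g j))"
proof -
  \<comment> \<open>This settles both empty and infinite \<open>J\<close>, where the sums are
    0.\<close>
  have zero: "B f 0 = 0"
  proof -
    have "B f (scale2 0 f) = 0 * B f f"
      using B f unfolding bilinear_form_on_def by blast
    then show ?thesis by (simp add: scale2_def)
  qed
  \<comment> \<open>Additivity is available only inside V, so the induction also carries membership
    of the partial sums.\<close>
  have "B f (\<Sum>j\<in>J. scale2 (c j) (g j)) = (\<Sum>j\<in>J. c j * B f (g j)) \<and>
    (\<Sum>j\<in>J. scale2 (c j) (g j)) \<in> homogeneous_space N"
    using g
  proof (induction J rule: infinite_finite_induct)
    case (insert x J)
    have "scale2 (c x) (g x) \<in> homogeneous_space N"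
      using insert.prems by (simp add: homogeneous_space_def poly2.span_scale)
    moreover have "B f (scale2 (c x) (g x)) = c x * B f (g x)"
      using B f insert.prems unfolding bilinear_form_on_def by blast
    moreover have "B f (u + v) = B f u + B f v"
      if "u \<in> homogeneous_space N" "v \<in> homogeneous_space N" for u v
      using B f that unfolding bilinear_form_on_def by blast
    ultimately show ?case
      using insert by (simp add: homogeneous_space_def poly2.span_add)
  qed (simp_all add: zero homogeneous_space_def poly2.span_zero)
  then show ?thesis ..
qed

lemma of_nat_neq_0_of_less_CHAR:
  assumes "0 < n" "CHAR('a::semiring_1) > 0 \<longrightarrow> n < CHAR('a)"
  shows "(of_nat n :: 'a) \<noteq> 0"
  using assms by (auto simp: of_nat_eq_0_iff_char_dvd dest: dvd_imp_le)

text \<open>Feasibility makes every factor of \<open>fact N\<close> nonzero in the field, and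
  \<open>N choose j\<close> divides \<open>fact N\<close>.\<close>

lemma of_nat_binomial_neq_0:
  assumes "feasible TYPE('a::field) (int N)" "j \<le> N"
  shows "(of_nat (N choose j) :: 'a) \<noteq> 0"
proof -
  have "(of_nat (fact n) :: 'a) \<noteq> 0" if "n \<le> N" for n
    using that
  proof (induction n)
    case (Suc n)
    then have "(of_nat (Suc n) :: 'a) \<noteq> 0"
      using assms(1) by (intro of_nat_neq_0_of_less_CHAR) (auto simp: feasible_def)
    with Suc show ?case
      by (simp only: fact_Suc of_nat_mult mult_eq_0_iff) simp
  qed simp
  from this[of N] show ?thesis
    by (metis assms(2) binomial_fact_lemma mult_zero_right of_nat_0 of_nat_mult order.refl)
qed

lemma inj_on_of_nat_feasible:
  assumes "feasible TYPE('a::field) (int N)"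
  shows "inj_on (of_nat :: nat \<Rightarrow> 'a) {..N}"
proof (rule linorder_inj_onI)
  fix m n assume "m < n" "n \<in> {..N}"
  then have "(of_nat (n - m) :: 'a) \<noteq> 0"
    using assms by (intro of_nat_neq_0_of_less_CHAR) (auto simp: feasible_def)
  with \<open>m < n\<close> show "(of_nat m :: 'a) \<noteq> of_nat n"
    by (simp add: of_nat_diff)
qed auto

text \<open>Both sides are linear in \<open>f\<close>, so monomials suffice. There orthogonality
  leaves a single term of the binomial expansion, whose coefficient cancels against the one in
  \<open>kcoeff\<close>.\<close>

lemma form_linear_power:
  fixes p :: "'a::field"
  assumes p: "p \<noteq> 0" "p \<noteq> 1"
    and feas: "feasible TYPE('a) (int N)"
    and B: "bilinear_form_on (homogeneous_space N) B"
    and mono: "\<And>i j. i \<le> N \<Longrightarrow> j \<le> N \<Longrightarrow>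
           B (var_y ^ (N - i) * var_z ^ i) (var_y ^ (N - j) * var_z ^ j) =
             (if i = j then 1 / (kcoeff N p i * (1 - p) ^ N) else 0)"
    and f: "f \<in> homogeneous_space N"
  shows "B f ((scale2 a var_y + scale2 b var_z) ^ N) = eval2 (a / (1 - p)) (b / p) f"
proof -
  let ?m = "\<lambda>j. var_y ^ (N - j) * var_z ^ j :: 'a poly poly"
  let ?L = "(scale2 a var_y + scale2 b var_z) ^ N"
  have m: "?m j \<in> homogeneous_space N" if "j \<le> N" for j
    using that by (auto simp: homogeneous_space_def intro!: poly2.span_base)
  have L: "?L \<in> homogeneous_space N"
    using linear_powers_in_homogeneous_space[of 0 N a b] by simp
  have monomial: "B (?m i) ?L = eval2 (a / (1 - p)) (b / p) (?m i)" if i: "i \<le> N" for i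
  proof -
    have "B (?m i) ?L =
        (\<Sum>j\<le>N. of_nat (N choose j) * a ^ (N - j) * b ^ j * B (?m i) (?m j))"
      unfolding power_scale2_add using m i by (intro bilinear_form_on_sum_right[OF B]) auto
    also have "\<dots> = (\<Sum>j\<le>N. if i = j then
        of_nat (N choose i) * a ^ (N - i) * b ^ i / (kcoeff N p i * (1 - p) ^ N) else 0)"
      using i by (intro sum.cong) (auto simp: mono)
    also have "\<dots> = of_nat (N choose i) * a ^ (N - i) * b ^ i / (kcoeff N p i * (1 - p) ^ N)"
      using i by simp
    \<comment> \<open>Splitting \<open>(1 - p) ^ N\<close> turns the denominator into
      \<open>of_nat (N choose i) * p ^ i * (1 - p) ^ (N - i)\<close>.\<close>
    also have "\<dots> = (a / (1 - p)) ^ (N - i) * (b / p) ^ i"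
    proof -
      have "(1 - p) ^ N = (1 - p) ^ (N - i) * (1 - p) ^ i"
        using i by (simp flip: power_add)
      then show ?thesis
        using p of_nat_binomial_neq_0[OF feas i]
        by (simp add: kcoeff_def power_divide field_simps)
    qed
    finally show ?thesis by simp
  qed
  have add: "B (u + v) ?L = B u ?L + B v ?L"
    if "u \<in> homogeneous_space N" "v \<in> homogeneous_space N" for u v
    using B L that unfolding bilinear_form_on_def by blast
  have scale: "B (scale2 c u) ?L = c * B u ?L" if "u \<in> homogeneous_space N" for c u
    using B L that unfolding bilinear_form_on_def by blast
  have "f \<in> homogeneous_space N \<and> B f ?L = eval2 (a / (1 - p)) (b / p) f"
    using f[unfolded homogeneous_space_def]
  proof (induction rule: poly2.span_induct_alt)
    case base
    have "(0 :: 'a poly poly) \<in> homogeneous_space N"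
      by (simp add: homogeneous_space_def poly2.span_zero)
    with scale[of 0 0] show ?case by (simp add: scale2_def[of 0])
  next
    case (step c x g)
    then obtain i where i: "i \<le> N" and x: "x = ?m i"
      by auto
    have "scale2 c x \<in> homogeneous_space N"
      using m[OF i] by (simp add: x homogeneous_space_def poly2.span_scale)
    moreover from this have "scale2 c x + g \<in> homogeneous_space N"
      using step.IH by (simp add: homogeneous_space_def poly2.span_add)
    moreover have "B (scale2 c x) ?L = c * eval2 (a / (1 - p)) (b / p) x"
      using scale[OF m[OF i]] monomial[OF i] by (simp add: x)
    ultimately show ?case
      using step.IH add by simp
  qed
  then show ?thesis ..
qed

theorem lemma3p16:
  fixes p :: "'a::alg_closed_field" and N :: nat
    and B :: "'a poly poly \<Rightarrow> 'a poly poly \<Rightarrow> 'a"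
  assumes "CHAR('a) \<noteq> 2"
    and "p \<noteq> 0" and "p \<noteq> 1"
    and "feasible TYPE('a) (int N)"
    and "bilinear_form_on (homogeneous_space N) B"
    and "\<And>i j. i \<le> N \<Longrightarrow> j \<le> N \<Longrightarrow>
           B (var_y ^ (N - i) * var_z ^ i) (var_y ^ (N - j) * var_z ^ j) =
             (if i = j then 1 / (kcoeff N p i * (1 - p) ^ N) else 0)"
  shows "\<forall>i\<le>N. \<forall>j\<le>N.
           B (y_star p ^ (N - i) * z_star p ^ i) (y_star p ^ (N - j) * z_star p ^ j) =
             (if i = j then inverse (kcoeff N p i) else 0)"
proof (intro allI impI)
  fix i j assume i: "i \<le> N" and j: "j \<le> N"
  let ?e = "\<lambda>j. y_star p ^ (N - j) * z_star p ^ j"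
  \<comment> \<open>\<open>P\<close> is the generating polynomial in t of the wanted values:
    \<open>c j\<close> is the coefficient of \<open>t ^ j\<close> when the pairing of
    \<open>?e i\<close> with the N-th power of y* + t z* is expanded.\<close>
  define c where "c j = of_nat (N choose j) * B (?e i) (?e j)" for j
  define P where "P = (\<Sum>j\<le>N. monom (c j) j)"
  have e: "?e j \<in> homogeneous_space N" if "j \<le> N" for j
    unfolding y_star_def z_star_def by (rule linear_powers_in_homogeneous_space[OF that])
  have "P = monom (((1 - p) / p) ^ i) i"
  \<comment> \<open>The values agree at every t; the images of 0, ..., N in the field are N + 1
    points, more than either degree.\<close>
  proof (rule poly_eqI_degree)
    fix t :: 'a
    have "poly P t = (\<Sum>j\<le>N. (of_nat (N choose j) * 1 ^ (N - j) * t ^ j) * B (?e i) (?e j))"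
      by (simp add: P_def c_def poly_sum poly_monom ac_simps)
    also have "\<dots> = B (?e i) ((scale2 1 (y_star p) + scale2 t (z_star p)) ^ N)"
      unfolding power_scale2_add
      using e i by (intro bilinear_form_on_sum_right[OF assms(5), symmetric]) auto
    also have "scale2 1 (y_star p) + scale2 t (z_star p) =
        scale2 ((1 - p) * (1 + t)) var_y + scale2 (p - t * (1 - p)) var_z"
      by (simp add: y_star_def z_star_def scale2_def var_y_def var_z_def algebra_simps)
    also have "B (?e i) (\<dots> ^ N) =
        eval2 ((1 - p) * (1 + t) / (1 - p)) ((p - t * (1 - p)) / p) (?e i)"
      using e[OF i] by (intro form_linear_power assms)
    also have "\<dots> = (t * ((1 - p) / p)) ^ i"
    \<comment> \<open>The evaluation point is (1 + t, 1 - t (1 - p) / p). The equations give y* and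
      z* there, with the coordinates left unsimplified so that they match the output of
      \<open>eval2_simps\<close>.\<close>
    proof -
      have "(1 - p) * ((1 - p) * (1 + t) / (1 - p)) + p * ((p - t * (1 - p)) / p) = 1"
        "(1 - p) * ((1 - p) * (1 + t) / (1 - p)) + (p - 1) * ((p - t * (1 - p)) / p)
          = t * ((1 - p) / p)"
        using assms(2,3) by (simp_all add: divide_simps) (simp_all add: algebra_simps)
      then show ?thesis
        by (simp only: y_star_def z_star_def eval2_simps power_one mult_1_left)
    qed
    also have "\<dots> = poly (monom (((1 - p) / p) ^ i) i) t"
      by (simp add: poly_monom power_mult_distrib power_divide mult.commute)
    finally show "poly P t = poly (monom (((1 - p) / p) ^ i) i) t" .
  next
    have card: "card ((of_nat :: nat \<Rightarrow> 'a) ` {..N}) = Suc N"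
      using inj_on_of_nat_feasible[OF assms(4)] by (simp add: card_image)
    have "degree P \<le> N"
      unfolding P_def by (intro degree_sum_le) (auto intro: order.trans[OF degree_monom_le])
    then show "degree P < card ((of_nat :: nat \<Rightarrow> 'a) ` {..N})"
      by (simp add: card)
    show "degree (monom (((1 - p) / p) ^ i) i) < card ((of_nat :: nat \<Rightarrow> 'a) ` {..N})"
      using i degree_monom_le[of "((1 - p) / p) ^ i" i] by (simp add: card)
  qed
  then have "coeff P j = (if i = j then ((1 - p) / p) ^ i else 0)"
    by simp
  moreover have "coeff P j = c j"
    using j by (simp add: P_def coeff_sum)
  ultimately have "of_nat (N choose j) * B (?e i) (?e j) = (if i = j then ((1 - p) / p) ^ i else 0)"
    by (simp add: c_def)
  \<comment> \<open>Dividing by the binomial coefficient gives the claim, since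
    \<open>((1 - p) / p) ^ i\<close> is the inverse of the power in \<open>kcoeff\<close>.\<close>
  then show "B (?e i) (?e j) = (if i = j then inverse (kcoeff N p i) else 0)"
    using of_nat_binomial_neq_0[OF assms(4) j] assms(2,3)
    by (auto simp: kcoeff_def field_simps power_divide split: if_splits)
qed

end
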